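(* Let $\mathbb{F}$ be an algebraically closed field of characteristic $p>2$ and let $L=L_{\bar 0}\oplus L_{\bar 1}$ be a restricted Lie superalgebra over $\mathbb{F}$. Then $$\mathrm{Der}_{\mathrm{res.}}(L)/\mathrm{ad}L=H^{1}_{*}(L;L),$$ where $H^1_*(L;L)$ is the $1$-dimensional restricted cohomology of $L$ with coefficients in the adjoint module.
   Context: $|x|\in\mathbb{Z}_2$ denotes the parity of a homogeneous element $x$; formulas involving parities are stated for homogeneous elements and extended linearly. A Lie superalgebra is a superspace $L=L_{\bar0}\oplus L_{\bar1}$ with an even bilinear bracket satisfying $[x,y]=-(-1)^{|x||y|}[y,x]$ and $[x,[y,z]]=[[x,y],z]+(-1)^{|x||y|}[y,[x,z]]$. A restricted Lie superalgebra is a Lie superalgebra $L$ with a map $[p]:L_{\bar0}\to L_{\bar0}$, $x\mapsto x^{[p]}$, such that $(L_{\bar0},[p])$ is a restricted Lie algebra and $L_{\bar1}$ is a restricted $L_{\bar0}$-module (i.e. $x^{[p]}$ acts as the $p$-th power of the action of $x$). A homogeneous linear map $D:L\to L$ of parity $|D|$ is a restricted superderivation if for all $x,y\in L$ and $z\in L_{\bar0}$: $D([x,y])=(-1)^{|D||x|}[x,D(y)]+[D(x),y]$ and $D(z^{[p]})=(\mathrm{ad}z)^{p-1}D(z)$. $\mathrm{Der}_{\mathrm{res.}}(L)$ is the direct sum of the space of even restricted superderivations and the space of odd restricted superderivations. For $x\in L$, $\mathrm{ad}x(y)=[x,y]$, and $\mathrm{ad}L=\{\mathrm{ad}x\mid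 x\in L\}\subseteq \mathrm{Der}_{\mathrm{res.}}(L)$. Restricted cohomology in degree $1$: for an $L$-module $M$ put $C^0_*(L;M)=M$ and $C^1_*(L;M)=\mathrm{Hom}_{\mathbb F}(L,M)$ (all linear maps, $\mathbb Z_2$-graded). Define $d^0_*(m)(x)=(-1)^{|x||m|}x m$ for $m\in M$, $x\in L$. For $\varphi\in C^1_*(L;M)$ define $$d^1\varphi(x,y)=-\varphi([x,y])+(-1)^{|x||\varphi|}x\varphi(y)-(-1)^{|y|(|x|+|\varphi|)}y\varphi(x)\quad(x,y\in L),$$ $$\mathrm{ind}^1(\varphi)(z)=\varphi(z^{[p]})-z^{p-1}\varphi(z)\quad(z\in L_{\bar0}),$$ and $d^1_*(\varphi)=(d^1\varphi,\mathrm{ind}^1(\varphi))$. Then $Z^1_*(L;M)=\mathrm{Ker}\,d^1_*=\{\varphi: d^1\varphi=0,\ \mathrm{ind}^1(\varphi)=0\}$, $B^1_*(L;M)=\mathrm{Im}\,d^0_*$ and $H^1_*(L;M)=Z^1_*(L;M)/B^1_*(L;M)$. The adjoint module is $M=L$ with $x\cdot y=[x,y]$. *)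

theory Defs
  imports
    "HOL-Library.Z2"
    "HOL-Library.Function_Algebras"
    "HOL-Computational_Algebra.Computational_Algebra"
begin

section \<open>Superspaces\<close>

text \<open>
  The group \<open>\<int>\<^sub>2\<close> of parities is the type \<open>bit\<close>, the two-element field. A superspace is a type
  carrying a vector space structure (given by its scalar multiplication) together with its
  homogeneous parts \<open>V 0\<close> and \<open>V 1\<close>.
\<close>

locale superspace = vector_space scale
  for scale :: "'f::field \<Rightarrow> 'v::ab_group_add \<Rightarrow> 'v" +
  fixes V :: "bit \<Rightarrow> 'v set"
  assumes subspace_part: "subspace (V a)"
    and parts_Int: "V 0 \<inter> V 1 = {0}"
    and parts_sum: "\<exists>x\<in>V 0. \<exists>y\<in>V 1. v = x + y"

text \<open>The vector \<open>(-1)\<^sup>e v\<close>, for a parity \<open>e\<close>.\<close>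

definition sgnd :: "bit \<Rightarrow> 'v::ab_group_add \<Rightarrow> 'v" where
  "sgnd e v = (if e = 0 then v else - v)"

text \<open>
  The component of parity \<open>a\<close> of a vector. It is used to extend to arbitrary vectors, by linearity,
  those formulas which involve the parities of their arguments.
\<close>

definition hcomp :: "(bit \<Rightarrow> 'v::ab_group_add set) \<Rightarrow> bit \<Rightarrow> 'v \<Rightarrow> 'v" where
  "hcomp V a v = (THE w. w \<in> V a \<and> v - w \<in> V (a + 1))"

definition lin_maps ::
  "('f::field \<Rightarrow> 'v::ab_group_add \<Rightarrow> 'v) \<Rightarrow> ('f \<Rightarrow> 'm::ab_group_add \<Rightarrow> 'm) \<Rightarrow> ('v \<Rightarrow> 'm) set" where
  "lin_maps sV sM = {f. Vector_Spaces.linear sV sM f}"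

definition hom_maps ::
  "('f::field \<Rightarrow> 'v::ab_group_add \<Rightarrow> 'v) \<Rightarrow> (bit \<Rightarrow> 'v set) \<Rightarrow>
   ('f \<Rightarrow> 'm::ab_group_add \<Rightarrow> 'm) \<Rightarrow> (bit \<Rightarrow> 'm set) \<Rightarrow> bit \<Rightarrow> ('v \<Rightarrow> 'm) set" where
  "hom_maps sV V sM M c = {f \<in> lin_maps sV sM. \<forall>a. f ` V a \<subseteq> M (a + c)}"

definition fun_scale :: "('f \<Rightarrow> 'm \<Rightarrow> 'm) \<Rightarrow> 'f \<Rightarrow> ('v \<Rightarrow> 'm) \<Rightarrow> 'v \<Rightarrow> 'm" where
  "fun_scale sM k f = (\<lambda>x. sM k (f x))"

section \<open>Quotients of superspaces\<close>

record ('f, 'q) superspace_on =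
  points :: "'q set"
  part :: "bit \<Rightarrow> 'q set"
  vzero :: 'q
  vadd :: "'q \<Rightarrow> 'q \<Rightarrow> 'q"
  vscale :: "'f \<Rightarrow> 'q \<Rightarrow> 'q"

definition coset :: "'u::ab_group_add set \<Rightarrow> 'u \<Rightarrow> 'u set" where
  "coset W v = {v + w | w. w \<in> W}"

text \<open>
  The quotient \<open>V / W\<close> of a subspace \<open>V\<close>, graded by \<open>G\<close>, of an ambient vector space with scalar
  multiplication \<open>s\<close>. The points are the cosets of \<open>W\<close>. In \<open>vscale\<close>, the summand from \<open>W\<close> only
  matters for the scalar 0.
\<close>

definition quotient_superspace ::
  "('f \<Rightarrow> 'u::ab_group_add \<Rightarrow> 'u) \<Rightarrow> 'u set \<Rightarrow> (bit \<Rightarrow> 'u set) \<Rightarrow> 'u set \<Rightarrow>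
   ('f, 'u set) superspace_on" where
  "quotient_superspace s V G W =
    \<lparr> points = coset W ` V,
      part = (\<lambda>c. coset W ` G c),
      vzero = W,
      vadd = (\<lambda>A B. {a + b | a b. a \<in> A \<and> b \<in> B}),
      vscale = (\<lambda>k A. {s k a + w | a w. a \<in> A \<and> w \<in> W}) \<rparr>"

section \<open>Restricted Lie superalgebras\<close>

locale lie_superalgebra = superspace scale L
  for scale :: "'f::field \<Rightarrow> 'v::ab_group_add \<Rightarrow> 'v" and L :: "bit \<Rightarrow> 'v set" +
  fixes br :: "'v \<Rightarrow> 'v \<Rightarrow> 'v"
  assumes linear_left: "Vector_Spaces.linear scale scale (\<lambda>x. br x y)"
    and linear_right: "Vector_Spaces.linear scale scale (br x)"
    and even: "x \<in> L a \<Longrightarrow> y \<in> L b \<Longrightarrow> br x y \<in> L (a + b)"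
    and super_skew: "x \<in> L a \<Longrightarrow> y \<in> L b \<Longrightarrow> br x y = - sgnd (a * b) (br y x)"
    and super_jacobi: "x \<in> L a \<Longrightarrow> y \<in> L b \<Longrightarrow>
      br x (br y z) = br (br x y) z + sgnd (a * b) (br y (br x z))"

text \<open>
  A polynomial in \<open>t\<close> with vector coefficients is represented by its sequence of coefficients.
  The operator \<open>ad (t x + y)\<close> acts on it as follows.
\<close>

definition ad_pencil ::
  "('v \<Rightarrow> 'v \<Rightarrow> 'v) \<Rightarrow> 'v::ab_group_add \<Rightarrow> 'v \<Rightarrow> (nat \<Rightarrow> 'v) \<Rightarrow> nat \<Rightarrow> 'v" where
  "ad_pencil br x y q = (\<lambda>k. (case k of 0 \<Rightarrow> 0 | Suc j \<Rightarrow> br x (q j)) + br y (q k))"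

text \<open>\<open>i s\<^sub>i(x,y)\<close> is the coefficient of \<open>t\<^bsup>i-1\<^esup>\<close> in \<open>(ad (t x + y))\<^bsup>p-1\<^esup>(x)\<close>, for \<open>1 \<le> i \<le> p - 1\<close>.\<close>

definition jacobson_s ::
  "('f::field \<Rightarrow> 'v::ab_group_add \<Rightarrow> 'v) \<Rightarrow> ('v \<Rightarrow> 'v \<Rightarrow> 'v) \<Rightarrow> nat \<Rightarrow> nat \<Rightarrow> 'v \<Rightarrow> 'v \<Rightarrow> 'v" where
  "jacobson_s scale br p i x y =
    scale (inverse (of_nat i))
      ((ad_pencil br x y ^^ (p - 1)) (\<lambda>k. if k = 0 then x else 0) (i - 1))"

text \<open>
  A restricted Lie algebra on the subspace \<open>A\<close> of the ambient vector space, over a field of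
  characteristic \<open>p\<close>. Nothing is assumed about \<open>br\<close> and \<open>pmap\<close> outside \<open>A\<close>.
\<close>

locale restricted_lie_algebra = vector_space scale
  for scale :: "'f::field \<Rightarrow> 'v::ab_group_add \<Rightarrow> 'v" +
  fixes A :: "'v set" and br :: "'v \<Rightarrow> 'v \<Rightarrow> 'v" and p :: nat and pmap :: "'v \<Rightarrow> 'v"
  assumes subspace_carrier: "subspace A"
    and br_closed: "x \<in> A \<Longrightarrow> y \<in> A \<Longrightarrow> br x y \<in> A"
    and br_add_left: "x \<in> A \<Longrightarrow> y \<in> A \<Longrightarrow> z \<in> A \<Longrightarrow> br (x + y) z = br x z + br y z"
    and br_add_right: "x \<in> A \<Longrightarrow> y \<in> A \<Longrightarrow> z \<in> A \<Longrightarrow> br x (y + z) = br x y + br x z"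
    and br_scale_left: "x \<in> A \<Longrightarrow> y \<in> A \<Longrightarrow> br (scale k x) y = scale k (br x y)"
    and br_scale_right: "x \<in> A \<Longrightarrow> y \<in> A \<Longrightarrow> br x (scale k y) = scale k (br x y)"
    and br_alternating: "x \<in> A \<Longrightarrow> br x x = 0"
    and br_jacobi: "x \<in> A \<Longrightarrow> y \<in> A \<Longrightarrow> z \<in> A \<Longrightarrow>
      br x (br y z) + br y (br z x) + br z (br x y) = 0"
    and pmap_closed: "x \<in> A \<Longrightarrow> pmap x \<in> A"
    and pmap_ad: "x \<in> A \<Longrightarrow> y \<in> A \<Longrightarrow> br (pmap x) y = (br x ^^ p) y"
    and pmap_scale: "x \<in> A \<Longrightarrow> pmap (scale k x) = scale (k ^ p) (pmap x)"
    and pmap_add: "x \<in> A \<Longrightarrow> y \<in> A \<Longrightarrow>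
      pmap (x + y) = pmap x + pmap y + (\<Sum>i = 1..p - 1. jacobson_s scale br p i x y)"

locale restricted_lie_superalgebra = lie_superalgebra scale L br
  for scale :: "'f::field \<Rightarrow> 'v::ab_group_add \<Rightarrow> 'v"
    and L :: "bit \<Rightarrow> 'v set" and br :: "'v \<Rightarrow> 'v \<Rightarrow> 'v" +
  fixes p :: nat and pmap :: "'v \<Rightarrow> 'v"
  assumes even_part_restricted: "restricted_lie_algebra scale (L 0) br p pmap"
    and odd_part_restricted: "z \<in> L 0 \<Longrightarrow> w \<in> L 1 \<Longrightarrow> br (pmap z) w = (br z ^^ p) w"

section \<open>Restricted superderivations\<close>

definition res_superders ::
  "('f::field \<Rightarrow> 'v::ab_group_add \<Rightarrow> 'v) \<Rightarrow> (bit \<Rightarrow> 'v set) \<Rightarrow> ('v \<Rightarrow> 'v \<Rightarrow> 'v) \<Rightarrow> nat \<Rightarrow> ('v \<Rightarrow> 'v) \<Rightarrow>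
   bit \<Rightarrow> ('v \<Rightarrow> 'v) set" where
  "res_superders scale L br p pmap d = {D \<in> hom_maps scale L scale L d.
    (\<forall>a. \<forall>x\<in>L a. \<forall>y. D (br x y) = sgnd (d * a) (br x (D y)) + br (D x) y) \<and>
    (\<forall>z\<in>L 0. D (pmap z) = (br z ^^ (p - 1)) (D z))}"

definition Der_res ::
  "('f::field \<Rightarrow> 'v::ab_group_add \<Rightarrow> 'v) \<Rightarrow> (bit \<Rightarrow> 'v set) \<Rightarrow> ('v \<Rightarrow> 'v \<Rightarrow> 'v) \<Rightarrow> nat \<Rightarrow> ('v \<Rightarrow> 'v) \<Rightarrow>
   ('v \<Rightarrow> 'v) set" where
  "Der_res scale L br p pmap =
    {D0 + D1 | D0 D1. D0 \<in> res_superders scale L br p pmap 0 \<and>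
                      D1 \<in> res_superders scale L br p pmap 1}"

definition ad_image :: "('v \<Rightarrow> 'v \<Rightarrow> 'v) \<Rightarrow> ('v \<Rightarrow> 'v) set" where
  "ad_image br = {(\<lambda>y. br x y) | x. True}"

section \<open>Restricted cohomology in degree 1\<close>

text \<open>
  Coefficients are taken in a module \<open>M\<close>, given by its scalar multiplication \<open>sM\<close>, its homogeneous
  parts \<open>M 0\<close>, \<open>M 1\<close> and the action \<open>act x m\<close> of \<open>x\<close> on \<open>m\<close>. The indices \<open>a\<close>, \<open>b\<close>, \<open>c\<close> are the
  parities of \<open>x\<close>, \<open>y\<close> (or \<open>m\<close>) and \<open>\<phi>\<close>; the sums run over homogeneous components.
\<close>

definition d0 ::
  "(bit \<Rightarrow> 'v::ab_group_add set) \<Rightarrow> (bit \<Rightarrow> 'm::ab_group_add set) \<Rightarrow> ('v \<Rightarrow> 'm \<Rightarrow> 'm) \<Rightarrow>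
   'm \<Rightarrow> 'v \<Rightarrow> 'm" where
  "d0 L M act m x = (\<Sum>a\<in>{0, 1}. \<Sum>b\<in>{0, 1}. sgnd (a * b) (act (hcomp L a x) (hcomp M b m)))"

definition d1 ::
  "('f::field \<Rightarrow> 'v::ab_group_add \<Rightarrow> 'v) \<Rightarrow> (bit \<Rightarrow> 'v set) \<Rightarrow> ('v \<Rightarrow> 'v \<Rightarrow> 'v) \<Rightarrow>
   ('f \<Rightarrow> 'm::ab_group_add \<Rightarrow> 'm) \<Rightarrow> (bit \<Rightarrow> 'm set) \<Rightarrow> ('v \<Rightarrow> 'm \<Rightarrow> 'm) \<Rightarrow>
   ('v \<Rightarrow> 'm) \<Rightarrow> 'v \<Rightarrow> 'v \<Rightarrow> 'm" where
  "d1 scale L br sM M act \<phi> x y =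
    (\<Sum>a\<in>{0, 1}. \<Sum>b\<in>{0, 1}. \<Sum>c\<in>{0, 1}.
      let xa = hcomp L a x; yb = hcomp L b y; \<phi>c = hcomp (hom_maps scale L sM M) c \<phi>
      in - \<phi>c (br xa yb) + sgnd (a * c) (act xa (\<phi>c yb)) - sgnd (b * (a + c)) (act yb (\<phi>c xa)))"

text \<open>\<open>ind1\<close> is meant for even \<open>z\<close> only. It involves no signs, hence no components.\<close>

definition ind1 ::
  "nat \<Rightarrow> ('v \<Rightarrow> 'v) \<Rightarrow> ('v \<Rightarrow> 'm \<Rightarrow> 'm) \<Rightarrow> ('v \<Rightarrow> 'm::ab_group_add) \<Rightarrow> 'v \<Rightarrow> 'm" where
  "ind1 p pmap act \<phi> z = \<phi> (pmap z) - (act z ^^ (p - 1)) (\<phi> z)"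

definition Z1_res ::
  "('f::field \<Rightarrow> 'v::ab_group_add \<Rightarrow> 'v) \<Rightarrow> (bit \<Rightarrow> 'v set) \<Rightarrow> ('v \<Rightarrow> 'v \<Rightarrow> 'v) \<Rightarrow> nat \<Rightarrow> ('v \<Rightarrow> 'v) \<Rightarrow>
   ('f \<Rightarrow> 'm::ab_group_add \<Rightarrow> 'm) \<Rightarrow> (bit \<Rightarrow> 'm set) \<Rightarrow> ('v \<Rightarrow> 'm \<Rightarrow> 'm) \<Rightarrow> ('v \<Rightarrow> 'm) set" where
  "Z1_res scale L br p pmap sM M act = {\<phi> \<in> lin_maps scale sM.
    (\<forall>x y. d1 scale L br sM M act \<phi> x y = 0) \<and> (\<forall>z\<in>L 0. ind1 p pmap act \<phi> z = 0)}"

definition B1_res ::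
  "(bit \<Rightarrow> 'v::ab_group_add set) \<Rightarrow> (bit \<Rightarrow> 'm::ab_group_add set) \<Rightarrow> ('v \<Rightarrow> 'm \<Rightarrow> 'm) \<Rightarrow>
   ('v \<Rightarrow> 'm) set" where
  "B1_res L M act = range (d0 L M act)"

definition H1_res ::
  "('f::field \<Rightarrow> 'v::ab_group_add \<Rightarrow> 'v) \<Rightarrow> (bit \<Rightarrow> 'v set) \<Rightarrow> ('v \<Rightarrow> 'v \<Rightarrow> 'v) \<Rightarrow> nat \<Rightarrow> ('v \<Rightarrow> 'v) \<Rightarrow>
   ('f \<Rightarrow> 'm::ab_group_add \<Rightarrow> 'm) \<Rightarrow> (bit \<Rightarrow> 'm set) \<Rightarrow> ('v \<Rightarrow> 'm \<Rightarrow> 'm) \<Rightarrow>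
   ('f, ('v \<Rightarrow> 'm) set) superspace_on" where
  "H1_res scale L br p pmap sM M act =
    quotient_superspace (fun_scale sM)
      (Z1_res scale L br p pmap sM M act)
      (\<lambda>c. Z1_res scale L br p pmap sM M act \<inter> hom_maps scale L sM M c)
      (B1_res L M act)"

end

theory Submission
  imports Defs
begin

text \<open>
  Write a linear map as \<open>\<phi> = \<phi>\<^sub>0 + \<phi>\<^sub>1\<close> with \<open>\<phi>\<^sub>c\<close> of parity \<open>c\<close>. On homogeneous arguments of
  parities \<open>a\<close>, \<open>b\<close> the cochain \<open>d1 \<phi>\<close> is the sum of the derivation defects of \<open>\<phi>\<^sub>0\<close> and \<open>\<phi>\<^sub>1\<close>,
  and these have the different parities \<open>a + b\<close> and \<open>a + b + 1\<close>; likewise for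
  \<open>ind1 \<phi>\<close>. Hence \<open>\<phi>\<close> is a restricted cocycle if and only if both \<open>\<phi>\<^sub>c\<close> are restricted
  superderivations. Super skew symmetry turns \<open>d0 m\<close> into \<open>ad (- m)\<close>. So the cocycles, their
  grading and the coboundaries agree with the superderivations, their grading and \<open>ad L\<close>.
\<close>

section \<open>Signs and uniqueness of homogeneous components\<close>

lemma sgnd_zero [simp]: "sgnd e 0 = 0"
  by (simp add: sgnd_def)

lemma sgnd_minus: "sgnd e (- v) = - sgnd e v"
  by (simp add: sgnd_def)

lemma sgnd_sgnd [simp]: "sgnd e (sgnd e v) = v"
  by (simp add: sgnd_def)

lemma sum_bit: "(\<Sum>c\<in>{0, 1}. F (c :: bit)) = F 0 + F 1"
  by simp

text \<open>Two candidates \<open>u\<close> and \<open>w\<close> differ by an element of both parts,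
  since \<open>u - w = (v - w) - (v - u)\<close>. The family \<open>V\<close> is arbitrary so that
  the argument serves both the parts of a superspace and the family \<open>hom_maps\<close> of
  homogeneous maps.\<close>

lemma hcomp_eqI:
  assumes diff: "\<And>c u v. u \<in> V c \<Longrightarrow> v \<in> V c \<Longrightarrow> u - v \<in> V c"
    and Int: "V 0 \<inter> V 1 = {0}"
    and w: "w \<in> V a" "v - w \<in> V (a + 1)"
  shows "hcomp V a v = w"
  unfolding hcomp_def
proof (rule the_equality)
  fix u assume u: "u \<in> V a \<and> v - u \<in> V (a + 1)"
  have "(v - w) - (v - u) \<in> V (a + 1)"
    using u w diff by blast
  moreover have "u - w \<in> V a"
    using u w diff by blast
  ultimately have "u - w \<in> V 0 \<inter> V 1"
    by (cases a) auto
  then show "u = w"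
    by (simp add: Int)
qed (use w in simp)

section \<open>Homogeneous components in a superspace\<close>

context superspace
begin

lemma part_zero: "0 \<in> V a"
  and part_add: "x \<in> V a \<Longrightarrow> y \<in> V a \<Longrightarrow> x + y \<in> V a"
  and part_diff: "x \<in> V a \<Longrightarrow> y \<in> V a \<Longrightarrow> x - y \<in> V a"
  and part_uminus: "x \<in> V a \<Longrightarrow> - x \<in> V a"
  using subspace_part[of a]
  by (auto intro: subspace_0 subspace_add subspace_diff subspace_neg)

lemma part_sgnd: "x \<in> V a \<Longrightarrow> sgnd e x \<in> V a"
  by (simp add: sgnd_def part_uminus)

text \<open>This separates parities: it later splits the vanishing of \<open>d1\<close> and
  \<open>ind1\<close> on a sum of an even and an odd map into one condition for each map.\<close>

lemma part_sum_eq_0: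
  assumes "x \<in> V a" "y \<in> V (a + 1)" "x + y = 0"
  shows "x = 0 \<and> y = 0"
proof -
  have "y = - x"
    using assms(3) by (simp add: eq_neg_iff_add_eq_0 add.commute)
  moreover have "y \<in> V a"
    using calculation assms(1) part_uminus by simp
  then have "y \<in> V 0 \<inter> V 1"
    using assms(2) by (cases a) auto
  ultimately show ?thesis
    using parts_Int by simp
qed

lemma hcomp_eq:
  assumes "w \<in> V a" "v - w \<in> V (a + 1)"
  shows "hcomp V a v = w"
  using hcomp_eqI[of V, OF part_diff parts_Int] assms by blast

lemma hcomp_part:
  assumes "x \<in> V a"
  shows "hcomp V b x = (if b = a then x else 0)"
proof (cases "b = a")
  case True
  then show ?thesis
    using assms by (simp add: hcomp_eq part_zero)
next
  case False
  then have "a = b + 1"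
    by (cases a; cases b) auto
  then show ?thesis
    using assms False by (simp add: hcomp_eq part_zero)
qed

lemma hcomp_in_part: "hcomp V a v \<in> V a"
  and hcomp_sum: "hcomp V 0 v + hcomp V 1 v = v"
proof -
  obtain x y where v: "x \<in> V 0" "y \<in> V 1" "v = x + y"
    using parts_sum by blast
  have *: "hcomp V 0 v = x" "hcomp V 1 v = y"
    using v by (auto intro!: hcomp_eq)
  show "hcomp V a v \<in> V a"
    by (cases a) (simp_all only: * v(1,2))
  show "hcomp V 0 v + hcomp V 1 v = v"
    unfolding * by (rule v(3)[symmetric])
qed

lemma diff_hcomp_in_part: "v - hcomp V a v \<in> V (a + 1)"
proof -
  have "v - hcomp V a v = hcomp V (a + 1) v"
    using hcomp_sum[of v] by (cases a) (simp_all add: diff_eq_eq add.commute)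
  then show ?thesis
    by (simp add: hcomp_in_part)
qed

lemma hcomp_add: "hcomp V a (u + v) = hcomp V a u + hcomp V a v"
proof (rule hcomp_eq)
  show "u + v - (hcomp V a u + hcomp V a v) \<in> V (a + 1)"
    using part_add[OF diff_hcomp_in_part[of u a] diff_hcomp_in_part[of v a]]
    by (simp add: algebra_simps)
qed (simp add: hcomp_in_part part_add)

lemma hcomp_scale: "hcomp V a (scale k v) = scale k (hcomp V a v)"
proof (rule hcomp_eq)
  show "scale k v - scale k (hcomp V a v) \<in> V (a + 1)"
    using subspace_scale[OF subspace_part diff_hcomp_in_part]
    by (simp flip: scale_right_diff_distrib)
qed (simp add: hcomp_in_part subspace_scale subspace_part)

section \<open>The grading of linear maps by parity\<close>

lemma lin_maps_iff:
  "f \<in> lin_maps scale scale \<longleftrightarrow>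
    (\<forall>u v. f (u + v) = f u + f v) \<and> (\<forall>k v. f (scale k v) = scale k (f v))"
  unfolding lin_maps_def mem_Collect_eq Vector_Spaces.linear_iff
  using vector_space_axioms by auto

lemma hom_maps_in_part: "f \<in> hom_maps scale V scale V c \<Longrightarrow> x \<in> V a \<Longrightarrow> f x \<in> V (a + c)"
  unfolding hom_maps_def by blast

lemma hom_maps_add: "f \<in> hom_maps scale V scale V c \<Longrightarrow> f (u + v) = f u + f v"
  by (simp add: hom_maps_def lin_maps_iff)

lemma hom_maps_0: "f \<in> hom_maps scale V scale V c \<Longrightarrow> f 0 = 0"
  using hom_maps_add[of f c 0 0] by simp

lemma zero_in_hom_maps: "0 \<in> hom_maps scale V scale V c"
  by (auto simp: hom_maps_def lin_maps_iff part_zero)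

lemma hom_maps_diff:
  assumes "f \<in> hom_maps scale V scale V c" "g \<in> hom_maps scale V scale V c"
  shows "f - g \<in> hom_maps scale V scale V c"
proof -
  have "f - g \<in> lin_maps scale scale"
    using assms by (simp add: hom_maps_def lin_maps_iff scale_right_diff_distrib)
  moreover have "(f - g) x \<in> V (a + c)" if "x \<in> V a" for a x
    using part_diff[OF hom_maps_in_part[OF assms(1) that] hom_maps_in_part[OF assms(2) that]]
    by (simp only: minus_apply)
  ultimately show ?thesis
    unfolding hom_maps_def by blast
qed

lemma hom_maps_Int: "hom_maps scale V scale V 0 \<inter> hom_maps scale V scale V 1 = {0}"
proof -
  have "f = 0" if f: "f \<in> hom_maps scale V scale V 0" "f \<in> hom_maps scale V scale V 1" for f
  proof
    fix x
    \<comment> \<open>Being even and odd at once, \<open>f\<close> sends \<open>y\<close> into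
      \<open>V a\<close> and into \<open>V (a + 1)\<close>, which meet only in 0.\<close>
    have "f y = 0" if "y \<in> V a" for y a
    proof -
      have "f y \<in> V 0 \<inter> V 1"
        using hom_maps_in_part[OF f(1) that] hom_maps_in_part[OF f(2) that] by (cases a) auto
      then show ?thesis
        by (simp add: parts_Int)
    qed
    then have "f (hcomp V a x) = 0" for a
      using hcomp_in_part by blast
    then show "f x = 0 x"
      using hom_maps_add[OF f(1), of "hcomp V 0 x" "hcomp V 1 x"]
      by (simp add: hcomp_sum)
  qed
  then show ?thesis
    using zero_in_hom_maps by auto
qed

text \<open>Removing one summand leaves the other, which has the opposite parity. This evaluates the
  components of the cochain that occur in \<open>d1\<close>.\<close>

lemma hcomp_hom_maps:
  assumes "f0 \<in> hom_maps scale V scale V 0" "f1 \<in> hom_maps scale V scale V 1"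
  shows "hcomp (hom_maps scale V scale V) 0 (f0 + f1) = f0"
    and "hcomp (hom_maps scale V scale V) 1 (f0 + f1) = f1"
  using assms
  by (auto intro!: hcomp_eqI[of "hom_maps scale V scale V", OF hom_maps_diff hom_maps_Int])

lemma hom_maps_decompose:
  assumes f: "f \<in> lin_maps scale scale"
  obtains f0 f1 where
    "f0 \<in> hom_maps scale V scale V 0" "f1 \<in> hom_maps scale V scale V 1" "f = f0 + f1"
proof
  \<comment> \<open>On a vector of parity \<open>a\<close>, the map \<open>g c\<close> keeps the
    component of parity \<open>a + c\<close> of the image. The sum over \<open>a\<close> extends
    this linearly to all vectors.\<close>
  define g where "g = (\<lambda>c x. \<Sum>a\<in>{0, 1}. hcomp V (a + c) (f (hcomp V a x)))"
  have add: "f (u + v) = f u + f v" and sc: "f (scale k v) = scale k (f v)" for u v k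
    using f by (auto simp: lin_maps_iff)
  have f0: "f 0 = 0"
    using add[of 0 0] by simp
  have hom: "g c \<in> hom_maps scale V scale V c" for c
  proof -
    have "g c \<in> lin_maps scale scale"
      by (simp add: g_def lin_maps_iff add sc hcomp_add hcomp_scale scale_right_distrib)
    moreover have "g c x = hcomp V (a + c) (f x)" if "x \<in> V a" for x a
      using that by (cases a) (simp_all add: g_def hcomp_part f0 part_zero)
    then have "g c ` V a \<subseteq> V (a + c)" for a
      using hcomp_in_part by auto
    ultimately show ?thesis
      by (simp add: hom_maps_def)
  qed
  show "g 0 \<in> hom_maps scale V scale V 0" "g 1 \<in> hom_maps scale V scale V 1"
    by (rule hom)+
  show "f = g 0 + g 1"
  proof
    fix x
    have "f x = f (hcomp V 0 x) + f (hcomp V 1 x)"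
      by (simp add: hcomp_sum flip: add)
    also have "\<dots> = (hcomp V 0 (f (hcomp V 0 x)) + hcomp V 1 (f (hcomp V 0 x)))
        + (hcomp V 0 (f (hcomp V 1 x)) + hcomp V 1 (f (hcomp V 1 x)))"
      by (simp only: hcomp_sum)
    finally show "f x = (g 0 + g 1) x"
      by (simp add: g_def algebra_simps)
  qed
qed

end

section \<open>Derivation defects and the cochain \<open>d1\<close>\<close>

context lie_superalgebra
begin

lemma br_add_left: "br (x + y) z = br x z + br y z"
  using linear_left[of z] by (simp add: Vector_Spaces.linear_iff)

lemma br_add_right: "br x (y + z) = br x y + br x z"
  using linear_right[of x] by (simp add: Vector_Spaces.linear_iff)

lemma br_0_left [simp]: "br 0 z = 0"
  using br_add_left[of 0 0 z] by simp

lemma br_0_right [simp]: "br x 0 = 0"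
  using br_add_right[of x 0 0] by simp

lemma br_minus_left: "br (- x) z = - br x z"
  using br_add_left[of x "- x" z] by (simp add: eq_neg_iff_add_eq_0 add.commute)

lemma br_pow_0: "(br z ^^ n) 0 = 0"
  by (induction n) simp_all

lemma br_pow_add: "(br z ^^ n) (u + v) = (br z ^^ n) u + (br z ^^ n) v"
  by (induction n) (simp_all add: br_add_right)

lemma br_pow_in_part: "z \<in> L 0 \<Longrightarrow> u \<in> L a \<Longrightarrow> (br z ^^ n) u \<in> L a"
proof (induction n)
  case (Suc n)
  then show ?case
    using even[of z 0 "(br z ^^ n) u" a] by (cases a) simp_all
qed simp

text \<open>The failure of the super Leibniz rule. The parity \<open>a\<close> of \<open>x\<close>
  is a separate argument because \<open>x\<close> alone does not determine it: 0 has both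
  parities.\<close>

definition der_defect :: "bit \<Rightarrow> ('v \<Rightarrow> 'v) \<Rightarrow> bit \<Rightarrow> 'v \<Rightarrow> 'v \<Rightarrow> 'v" where
  "der_defect c f a x y = sgnd (c * a) (br x (f y)) + br (f x) y - f (br x y)"

lemma der_defect_in_part:
  assumes f: "f \<in> hom_maps scale L scale L c" and x: "x \<in> L a" and y: "y \<in> L b"
  shows "der_defect c f a x y \<in> L (a + b + c)"
proof -
  have "br x (f y) \<in> L (a + b + c)"
    using even[OF x hom_maps_in_part[OF f y]] by (simp only: add.assoc)
  moreover have "br (f x) y \<in> L (a + b + c)"
    using even[OF hom_maps_in_part[OF f x] y] by (simp only: ac_simps)
  moreover have "f (br x y) \<in> L (a + b + c)"
    using hom_maps_in_part[OF f even[OF x y]] .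
  ultimately show ?thesis
    by (simp add: der_defect_def part_add part_diff part_sgnd)
qed

lemma der_defect_add_right:
  assumes "f \<in> hom_maps scale L scale L c"
  shows "der_defect c f a x (y + y') = der_defect c f a x y + der_defect c f a x y'"
  by (simp add: der_defect_def hom_maps_add[OF assms] br_add_right sgnd_def)

text \<open>As \<open>f x\<close> has parity \<open>a + c\<close>, the sign of the last term is
  exactly the one produced by super skew symmetry when \<open>br y (f x)\<close> is turned into
  \<open>br (f x) y\<close>.\<close>

lemma d1_summand_eq_der_defect:
  assumes f: "f \<in> hom_maps scale L scale L c" and x: "x \<in> L a" and y: "y \<in> L b"
  shows "- f (br x y) + sgnd (a * c) (br x (f y)) - sgnd (b * (a + c)) (br y (f x))
    = der_defect c f a x y"
proof -
  have "br (f x) y = - sgnd (b * (a + c)) (br y (f x))"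
    using super_skew[OF hom_maps_in_part[OF f x] y] by (simp only: mult.commute)
  then show ?thesis
    by (simp add: der_defect_def mult.commute)
qed

lemma d1_hom_sum:
  assumes "f0 \<in> hom_maps scale L scale L 0" "f1 \<in> hom_maps scale L scale L 1"
  shows "d1 scale L br scale L br (f0 + f1) x y = (\<Sum>a\<in>{0, 1}. \<Sum>b\<in>{0, 1}.
    der_defect 0 f0 a (hcomp L a x) (hcomp L b y) + der_defect 1 f1 a (hcomp L a x) (hcomp L b y))"
  unfolding d1_def Let_def sum_bit hcomp_hom_maps[OF assms]
    d1_summand_eq_der_defect[OF assms(1) hcomp_in_part hcomp_in_part]
    d1_summand_eq_der_defect[OF assms(2) hcomp_in_part hcomp_in_part] ..

text \<open>Of the four pairs of components only the one of parities \<open>a\<close>,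
  \<open>b\<close> survives: a defect with a zero argument vanishes.\<close>

lemma d1_hom_sum_homogeneous:
  assumes f: "f0 \<in> hom_maps scale L scale L 0" "f1 \<in> hom_maps scale L scale L 1"
    and x: "x \<in> L a" and y: "y \<in> L b"
  shows "d1 scale L br scale L br (f0 + f1) x y = der_defect 0 f0 a x y + der_defect 1 f1 a x y"
proof -
  have "der_defect 0 f0 a 0 y = 0" "der_defect 1 f1 a 0 y = 0"
    "der_defect 0 f0 a x 0 = 0" "der_defect 1 f1 a x 0 = 0" for a x y
    by (simp_all add: der_defect_def hom_maps_0[OF f(1)] hom_maps_0[OF f(2)])
  then show ?thesis
    by (cases a; cases b) (simp_all add: d1_hom_sum[OF f] hcomp_part[OF x] hcomp_part[OF y])
qed

text \<open>The Leibniz rule in \<open>res_superders\<close> takes arbitrary \<open>y\<close>,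
  whereas comparing parities needs homogeneous \<open>y\<close>. The defect is additive in
  \<open>y\<close>, so both versions are equivalent.\<close>

lemma res_superders_iff:
  "D \<in> res_superders scale L br p pmap c \<longleftrightarrow> D \<in> hom_maps scale L scale L c \<and>
    (\<forall>a b. \<forall>x\<in>L a. \<forall>y\<in>L b. der_defect c D a x y = 0) \<and> (\<forall>z\<in>L 0. ind1 p pmap br D z = 0)"
proof -
  have "D (br x y) = sgnd (c * a) (br x (D y)) + br (D x) y"
    if D: "D \<in> hom_maps scale L scale L c"
      and "\<forall>a b. \<forall>x\<in>L a. \<forall>y\<in>L b. der_defect c D a x y = 0" "x \<in> L a" for x y a
  proof -
    have "der_defect c D a x (hcomp L 0 y + hcomp L 1 y) = 0"
    proof -
      have "der_defect c D a x (hcomp L b y) = 0" for b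
        using that hcomp_in_part by blast
      then show ?thesis
        by (simp add: der_defect_add_right[OF D])
    qed
    then show ?thesis
      by (simp add: hcomp_sum der_defect_def)
  qed
  moreover have "der_defect c D a x y = 0"
    if "\<forall>a. \<forall>x\<in>L a. \<forall>y. D (br x y) = sgnd (c * a) (br x (D y)) + br (D x) y" "x \<in> L a" for x y a
    using that by (simp add: der_defect_def)
  ultimately show ?thesis
    unfolding res_superders_def ind1_def mem_Collect_eq right_minus_eq by blast
qed

lemma zero_in_res_superders: "0 \<in> res_superders scale L br p pmap c"
  by (simp add: res_superders_iff zero_in_hom_maps der_defect_def ind1_def br_pow_0)

section \<open>Coboundaries and inner superderivations\<close>

lemma ad_image_eq_B1_res: "ad_image br = B1_res L L br"
proof -
  have "d0 L L br m x = br (- m) x" for m x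
  proof -
    \<comment> \<open>The sign in \<open>d0\<close> cancels the sign of super skew symmetry, so the
      right side no longer depends on the parities and the components recombine by
      bilinearity.\<close>
    have "sgnd (a * b) (br (hcomp L a x) (hcomp L b m)) = - br (hcomp L b m) (hcomp L a x)" for a b
      by (simp only: super_skew[OF hcomp_in_part[of a x] hcomp_in_part[of b m]] sgnd_minus sgnd_sgnd)
    then have "d0 L L br m x = - (br (hcomp L 0 m + hcomp L 1 m) (hcomp L 0 x + hcomp L 1 x))"
      by (simp add: d0_def br_add_left br_add_right)
    then show ?thesis
      by (simp add: hcomp_sum br_minus_left)
  qed
  then have d0: "d0 L L br m = br (- m)" for m
    by (simp add: fun_eq_iff)
  have "br x \<in> range (\<lambda>m. br (- m))" for x
    by (rule range_eqI[of _ _ "- x"]) simp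
  then show ?thesis
    unfolding B1_res_def ad_image_def d0 by blast
qed

end

section \<open>Restricted cocycles and restricted superderivations\<close>

context restricted_lie_superalgebra
begin

lemma pmap_in_part: "z \<in> L 0 \<Longrightarrow> pmap z \<in> L 0"
  using even_part_restricted by (rule restricted_lie_algebra.pmap_closed)

text \<open>For even \<open>z\<close>, both \<open>pmap z\<close> and the operator
  \<open>br z\<close> are even, so each term of \<open>ind1\<close> has the parity of
  \<open>f\<close>.\<close>

lemma ind1_in_part:
  assumes "f \<in> hom_maps scale L scale L c" "z \<in> L 0"
  shows "ind1 p pmap br f z \<in> L c"
  using hom_maps_in_part[OF assms] hom_maps_in_part[OF assms(1) pmap_in_part[OF assms(2)]]
  by (cases c) (simp_all add: ind1_def part_diff br_pow_in_part assms(2))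

lemma Z1_res_iff_components:
  assumes f: "f0 \<in> hom_maps scale L scale L 0" "f1 \<in> hom_maps scale L scale L 1"
  shows "f0 + f1 \<in> Z1_res scale L br p pmap scale L br \<longleftrightarrow>
    f0 \<in> res_superders scale L br p pmap 0 \<and> f1 \<in> res_superders scale L br p pmap 1"
    (is "?Z \<longleftrightarrow> ?R")
proof -
  have ind: "ind1 p pmap br (f0 + f1) z = ind1 p pmap br f0 z + ind1 p pmap br f1 z" for z
    by (simp add: ind1_def br_pow_add)
  show ?thesis
  proof
    assume ?Z
    \<comment> \<open>The two defects have parities \<open>a + b\<close> and
      \<open>a + b + 1\<close>, and their sum is a value of \<open>d1\<close>, which is 0 for a
      cocycle.\<close>
    have "der_defect 0 f0 a x y = 0 \<and> der_defect 1 f1 a x y = 0" if "x \<in> L a" "y \<in> L b" for a b x y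
      using \<open>?Z\<close> der_defect_in_part[OF f(1) that] der_defect_in_part[OF f(2) that]
      by (intro part_sum_eq_0[of _ "a + b"])
        (simp_all add: Z1_res_def flip: d1_hom_sum_homogeneous[OF f that])
    \<comment> \<open>The same separation in parities 0 and 1.\<close>
    moreover have "ind1 p pmap br f0 z = 0 \<and> ind1 p pmap br f1 z = 0" if "z \<in> L 0" for z
      using \<open>?Z\<close> ind1_in_part[OF f(1) that] ind1_in_part[OF f(2) that] that
      by (intro part_sum_eq_0[of _ 0]) (simp_all add: Z1_res_def flip: ind)
    ultimately show ?R
      using f by (auto simp: res_superders_iff)
  next
    assume ?R
    then have "der_defect 0 f0 a (hcomp L a x) (hcomp L b y) = 0"
        "der_defect 1 f1 a (hcomp L a x) (hcomp L b y) = 0" for a b x y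
      unfolding res_superders_iff using hcomp_in_part by blast+
    then have "d1 scale L br scale L br (f0 + f1) x y = 0" for x y
      by (simp add: d1_hom_sum[OF f])
    moreover have "f0 + f1 \<in> lin_maps scale scale"
      using f by (simp add: hom_maps_def lin_maps_iff scale_right_distrib algebra_simps)
    ultimately show ?Z
      using \<open>?R\<close> by (simp add: Z1_res_def res_superders_iff ind)
  qed
qed

lemma Der_res_eq_Z1_res: "Der_res scale L br p pmap = Z1_res scale L br p pmap scale L br"
proof (rule set_eqI, rule iffI)
  fix f assume "f \<in> Der_res scale L br p pmap"
  then show "f \<in> Z1_res scale L br p pmap scale L br"
    unfolding Der_res_def using Z1_res_iff_components by (auto simp: res_superders_iff)
next
  fix f assume f: "f \<in> Z1_res scale L br p pmap scale L br"
  then obtain f0 f1 where "f0 \<in> hom_maps scale L scale L 0" "f1 \<in> hom_maps scale L scale L 1"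
    "f = f0 + f1"
    by (auto simp: Z1_res_def elim: hom_maps_decompose)
  then show "f \<in> Der_res scale L br p pmap"
    using f Z1_res_iff_components by (auto simp: Der_res_def)
qed

text \<open>A homogeneous map is decomposed as \<open>f + 0\<close> or \<open>0 + f\<close>; the
  zero map is a restricted superderivation of either parity.\<close>

lemma res_superders_eq_Z1_res_part:
  "res_superders scale L br p pmap c =
    Z1_res scale L br p pmap scale L br \<inter> hom_maps scale L scale L c"
proof -
  have "f \<in> Z1_res scale L br p pmap scale L br \<longleftrightarrow> f \<in> res_superders scale L br p pmap c"
    if "f \<in> hom_maps scale L scale L c" for f
    using that Z1_res_iff_components[of f 0] Z1_res_iff_components[of 0 f]
    by (cases c) (simp_all add: zero_in_hom_maps zero_in_res_superders)
  then show ?thesis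
    by (auto simp: res_superders_iff)
qed

end

theorem theorem3p2:
  fixes scale :: "'f::alg_closed_field \<Rightarrow> 'v::ab_group_add \<Rightarrow> 'v"
    and L :: "bit \<Rightarrow> 'v set"
    and br :: "'v \<Rightarrow> 'v \<Rightarrow> 'v"
    and pmap :: "'v \<Rightarrow> 'v"
    and p :: nat
  assumes "CHAR('f) = p" and "p > 2"
    and "restricted_lie_superalgebra scale L br p pmap"
  shows "quotient_superspace (fun_scale scale)
           (Der_res scale L br p pmap) (res_superders scale L br p pmap) (ad_image br)
         = H1_res scale L br p pmap scale L br"
proof -
  interpret restricted_lie_superalgebra scale L br p pmap
    by (fact assms(3))
  show ?thesis
    unfolding H1_res_def ad_image_eq_B1_res Der_res_eq_Z1_res
    \<comment> \<open>Points and divided subspace already agree; what remains is to identify the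
      gradings, one parity at a time.\<close>
    by (rule arg_cong[where f = "\<lambda>G. quotient_superspace _ _ G _"])
      (rule ext, rule res_superders_eq_Z1_res_part)
qed

end
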